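(* Let $m\ge 2$, $n,\ell\ge 1$ be integers, let $\Omega:\mathbb{R}^n\rightrightarrows\mathbb{R}^\ell$ be a closed-valued set-valued mapping, and for each $\omega\in\mathbb{R}^\ell$ let $\mathcal{B}(\omega)$ be a real tensor of order $m$ and dimension $n$. Define $$C=\{v\in\mathbb{R}^n: v>0,\ \mathcal{B}(\omega)v^{m-1}>0 \text{ for some } \omega\in\Omega(v)\},$$ $$C'=\{v\in\mathbb{R}^n: v\neq 0,\ v\ge 0,\ \mathcal{B}(\omega)v^{m-1}>0 \text{ for some } \omega\in\Omega(v)\}.$$ If $\Omega$ is inner semicontinuous (at every point of $\mathbb{R}^n$) and the mapping $\omega\mapsto\mathcal{B}(\omega)$ is continuous, then $C'\neq\emptyset$ implies $C\neq\emptyset$.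
   Context: A real tensor of order $m$ and dimension $n$ is an array $\mathcal{B}=(b_{i_1\ldots i_m})$ of real numbers with $i_j\in\{1,\ldots,n\}$; continuity of $\omega\mapsto\mathcal{B}(\omega)$ means continuity of every entry. For $v\in\mathbb{R}^n$, $\mathcal{B}v^{m-1}\in\mathbb{R}^n$ is the vector with components $(\mathcal{B}v^{m-1})_i=\sum_{i_2,\ldots,i_m=1}^n b_{i i_2\ldots i_m}v_{i_2}\cdots v_{i_m}$. Vector inequalities $\ge 0$, $>0$ are componentwise. A set-valued mapping $\Omega:\mathbb{R}^n\rightrightarrows\mathbb{R}^\ell$ assigns to each $v\in\mathbb{R}^n$ a subset $\Omega(v)\subseteq\mathbb{R}^\ell$; it is closed-valued if every $\Omega(v)$ is closed. It is inner semicontinuous at $\bar v$ if $\Omega(\bar v)\subseteq\liminf_{v\to\bar v}\Omega(v)$, where $\liminf_{v\to\bar v}\Omega(v)$ is the set of all $u$ such that for every sequence $v^k\to\bar v$ there is a sequence $u^k\to u$ with $u^k\in\Omega(v^k)$. *)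

theory Defs
  imports "HOL-Analysis.Analysis"
begin

text \<open>
  A real tensor of order \<open>m\<close> and dimension \<open>CARD('n)\<close> is represented by its entries: the
  multi-index \<open>(i\<^sub>1, \<dots>, i\<^sub>m)\<close> is the list \<open>[i\<^sub>1, \<dots>, i\<^sub>m]\<close>.  Only lists of length \<open>m\<close> are
  multi-indices of a tensor of order \<open>m\<close>; the values at other lists are never used.
\<close>

type_synonym 'n tensor = "'n list \<Rightarrow> real"

text \<open>The vector \<open>B v\<^sup>m\<^sup>-\<^sup>1\<close>, for \<open>B\<close> of order \<open>m \<ge> 1\<close>; \<open>js\<close> is \<open>[i\<^sub>2, \<dots>, i\<^sub>m]\<close>.\<close>

definition tensor_apply :: "nat \<Rightarrow> 'n::finite tensor \<Rightarrow> real ^ 'n \<Rightarrow> real ^ 'n" where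
  "tensor_apply m B v =
     (\<chi> i. \<Sum>js | length js = m - 1. B (i # js) * (\<Prod>j\<leftarrow>js. v $ j))"

definition continuous_tensor :: "nat \<Rightarrow> ('a::topological_space \<Rightarrow> 'n tensor) \<Rightarrow> bool" where
  "continuous_tensor m B \<longleftrightarrow>
     (\<forall>is. length is = m \<longrightarrow> continuous_on UNIV (\<lambda>\<omega>. B \<omega> is))"

text \<open>The library's \<open><\<close> on vectors is not the componentwise strict order.\<close>

definition vec_nonneg :: "real ^ 'n \<Rightarrow> bool" where
  "vec_nonneg v \<longleftrightarrow> (\<forall>i. 0 \<le> v $ i)"

definition vec_pos :: "real ^ 'n \<Rightarrow> bool" where
  "vec_pos v \<longleftrightarrow> (\<forall>i. 0 < v $ i)"

definition closed_valued :: "('a \<Rightarrow> 'b::topological_space set) \<Rightarrow> bool" where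
  "closed_valued \<Omega> \<longleftrightarrow> (\<forall>v. closed (\<Omega> v))"

text \<open>The inner limit of \<open>\<Omega>\<close> at \<open>v\<close>; the sequences approaching \<open>v\<close> may take the value \<open>v\<close>.\<close>

definition set_liminf ::
  "('a::topological_space \<Rightarrow> 'b::topological_space set) \<Rightarrow> 'a \<Rightarrow> 'b set" where
  "set_liminf \<Omega> v =
     {u. \<forall>vs. vs \<longlonglongrightarrow> v \<longrightarrow> (\<exists>us. us \<longlonglongrightarrow> u \<and> (\<forall>k::nat. us k \<in> \<Omega> (vs k)))}"

definition inner_semicontinuous_at ::
  "('a::topological_space \<Rightarrow> 'b::topological_space set) \<Rightarrow> 'a \<Rightarrow> bool" where
  "inner_semicontinuous_at \<Omega> v \<longleftrightarrow> \<Omega> v \<subseteq> set_liminf \<Omega> v"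

definition C_set ::
  "nat \<Rightarrow> ('b \<Rightarrow> 'n::finite tensor) \<Rightarrow> (real ^ 'n \<Rightarrow> 'b set) \<Rightarrow> (real ^ 'n) set" where
  "C_set m B \<Omega> = {v. vec_pos v \<and> (\<exists>\<omega>\<in>\<Omega> v. vec_pos (tensor_apply m (B \<omega>) v))}"

definition C'_set ::
  "nat \<Rightarrow> ('b \<Rightarrow> 'n::finite tensor) \<Rightarrow> (real ^ 'n \<Rightarrow> 'b set) \<Rightarrow> (real ^ 'n) set" where
  "C'_set m B \<Omega> =
     {v. v \<noteq> 0 \<and> vec_nonneg v \<and> (\<exists>\<omega>\<in>\<Omega> v. vec_pos (tensor_apply m (B \<omega>) v))}"

end

theory Submission
  imports Defs
begin

text \<open>
  Push a point \<open>v\<close> of \<open>C'\<close> into the open positive orthant along \<open>v + t (1, \<dots>, 1)\<close>,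
  \<open>t \<down> 0\<close>.  Inner semicontinuity lets the witness \<open>\<omega> \<in> \<Omega> v\<close> follow the perturbed
  points, and positivity of all components of \<open>B \<omega> v\<^sup>m\<^sup>-\<^sup>1\<close> is an open condition in
  \<open>(\<omega>, v)\<close>.
\<close>

lemma tendsto_prod_list_map:
  fixes f :: "'a \<Rightarrow> 'b \<Rightarrow> 'c::{monoid_mult, topological_semigroup_mult}"
  assumes "\<And>x. x \<in> set xs \<Longrightarrow> ((\<lambda>k. f k x) \<longlongrightarrow> g x) F"
  shows "((\<lambda>k. \<Prod>x\<leftarrow>xs. f k x) \<longlongrightarrow> (\<Prod>x\<leftarrow>xs. g x)) F"
  using assms by (induction xs) (auto intro!: tendsto_mult)

text \<open>Each component is a polynomial in the entries of the tensor and the coordinates of the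
  vector, hence jointly continuous. Since \<open>m > 0\<close>, the lists \<open>i # js\<close> have
  length exactly \<open>m\<close>, the only length for which \<open>continuous_tensor\<close> gives
  continuity.\<close>

lemma tendsto_tensor_apply:
  assumes "continuous_tensor m B" and "m > 0"
    and "(w \<longlongrightarrow> \<omega>) F" and v: "(v \<longlongrightarrow> v0) F"
  shows "((\<lambda>k. tensor_apply m (B (w k)) (v k)) \<longlongrightarrow> tensor_apply m (B \<omega>) v0) F"
proof -
  have "((\<lambda>k. B (w k) (i # js)) \<longlongrightarrow> B \<omega> (i # js)) F" if "length js = m - 1" for i js
  proof -
    have "continuous_on UNIV (\<lambda>\<omega>. B \<omega> (i # js))"
      using assms(1,2) that by (simp add: continuous_tensor_def)
    then show ?thesis
      using assms(3) by (rule continuous_on_tendsto_compose) simp_all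
  qed
  moreover have "((\<lambda>k. v k $ j) \<longlongrightarrow> v0 $ j) F" for j
    using v by (rule tendsto_vec_nth)
  ultimately show ?thesis
    unfolding tensor_apply_def
    by (intro tendsto_vec_lambda tendsto_sum tendsto_mult tendsto_prod_list_map) auto
qed

text \<open>Finitely many strict inequalities, each stable under small perturbations, hold
  simultaneously.\<close>

lemma eventually_vec_pos:
  assumes "(x \<longlongrightarrow> a) F" and "vec_pos a"
  shows "\<forall>\<^sub>F k in F. vec_pos (x k)"
  unfolding vec_pos_def
proof (rule eventually_all_finite)
  fix i
  show "\<forall>\<^sub>F k in F. 0 < x k $ i"
    using tendsto_vec_nth[OF assms(1)] assms(2) by (intro order_tendstoD(1)) (auto simp: vec_pos_def)
qed

theorem theorem3p1:
  fixes m :: nat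
    and \<Omega> :: "real ^ 'n::finite \<Rightarrow> (real ^ 'l::finite) set"
    and B :: "real ^ 'l \<Rightarrow> 'n tensor"
  assumes "m \<ge> 2"
    and "closed_valued \<Omega>"
    and "\<And>v. inner_semicontinuous_at \<Omega> v"
    and "continuous_tensor m B"
    and "C'_set m B \<Omega> \<noteq> {}"
  shows "C_set m B \<Omega> \<noteq> {}"
proof -
  obtain v \<omega> where v: "vec_nonneg v" and "\<omega> \<in> \<Omega> v" and pos: "vec_pos (tensor_apply m (B \<omega>) v)"
    using assms(5) by (auto simp: C'_set_def)
  \<comment> \<open>\<open>Suc k\<close> keeps the shift positive at \<open>k = 0\<close> too, where
    \<open>inverse 0 = 0\<close> would leave \<open>v\<close> in place.\<close>
  define vs :: "nat \<Rightarrow> real ^ 'n" where "vs k = v + (\<chi> i. inverse (real (Suc k)))" for k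
  have "vs \<longlonglongrightarrow> v + (\<chi> i. 0)"
    unfolding vs_def by (intro tendsto_add tendsto_const tendsto_vec_lambda LIMSEQ_inverse_real_of_nat)
  then have vs: "vs \<longlonglongrightarrow> v"
    by (simp flip: zero_vec_def)
  have vs_pos: "vec_pos (vs k)" for k
    using v by (simp add: vec_pos_def vec_nonneg_def vs_def add_nonneg_pos)
  \<comment> \<open>The inner limit, applied to the sequence \<open>vs\<close>, yields a point of
    \<open>\<Omega> (vs k)\<close> for every \<open>k\<close>, so any index found later will
    do.\<close>
  obtain us where us: "us \<longlonglongrightarrow> \<omega>" "\<And>k. us k \<in> \<Omega> (vs k)"
    using assms(3)[of v] \<open>\<omega> \<in> \<Omega> v\<close> vs unfolding inner_semicontinuous_at_def set_liminf_def by blast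
  have "(\<lambda>k. tensor_apply m (B (us k)) (vs k)) \<longlonglongrightarrow> tensor_apply m (B \<omega>) v"
    using assms(1,4) us(1) vs by (intro tendsto_tensor_apply) auto
  then have "\<forall>\<^sub>F k in sequentially. vec_pos (tensor_apply m (B (us k)) (vs k))"
    using pos by (rule eventually_vec_pos)
  then obtain k where "vec_pos (tensor_apply m (B (us k)) (vs k))"
    by (auto simp: eventually_sequentially)
  then have "vs k \<in> C_set m B \<Omega>"
    using vs_pos us(2) by (auto simp: C_set_def)
  then show ?thesis by blast
qed

end
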